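(* Let $S$ be a set with a tolerance relation $T$, let $Gr(S)\subseteq\wp(S)$ be a collection of granules with $\bigcup Gr(S)=S$, and let $\wp(S)|\sim$ be the associated quotient. Assume that for every pair of elements $a,b$ of $\wp(S)|\sim$ the set $UB(a,b)$ of minimal upper bounds and the set $LB(a,b)$ of maximal lower bounds of $a$ and $b$ are nonempty. Let $\lambda$ be a choice function on $\wp(S)|\sim$ and let $\mathfrak{B}=\langle\wp(S)|\sim,+,\cdot,L,{\diamond},\neg\rangle$ be the resulting simplified algebra of the bitten granular semantics, where $a+b=\lambda(UB(a,b))$ and $a\cdot b=\lambda(LB(a,b))$. Put $0=[\emptyset]$ and $1=[S]$. Then all of the following hold for all elements $a,b,c$ of $\mathfrak{B}$: \begin{enumerate} \item $\langle\wp(S)|\sim,+,\cdot\rangle$ is a $\lambda$-lattice; \item $a+b=b+a$ and $a\cdot b=b\cdot a$; \item $a+a=a$ and $a\cdot a=a$; \item $a+(a\cdot b)=a$ and $a\cdot(a+b)=a$; \item $a+(a+(b+c))=a+(b+c)$ and $a\cdot(a\cdot(b\cdot c))=a\cdot(b\cdot c)$; \item $a+La=a$ and $a\cdot La=La$; \item $a+{\diamond} a={\diamond} a$ and $a\cdot{\diamond} a=a$; \item $L(La)=La$ and ${\diamond}({\diamond} a)={\diamond} a$; \item if $a+b=a$ then $La+Lb=La$; and if $a\cdot b=a$ then $La\cdot Lb=La$; \item if $a+b=a$ then ${\diamond} a+{\diamond} b={\diamond} a$; and if $a\cdot b=a$ then ${\diamond} a\cdot{\diamond} b={\diamond} a$;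 \item $\neg(La)={\diamond}(\neg a)$ and $\neg({\diamond} a)=L(\neg a)$; \item $L0=0$, $L1=1$, ${\diamond} 0=0$ and ${\diamond} 1=1$; \item $L{\diamond} a+{\diamond} a={\diamond} a$ and $L{\diamond} a\cdot{\diamond} a=L{\diamond} a$; \item $La+{\diamond} La={\diamond} La$ and $La\cdot{\diamond} La=La$. \end{enumerate}
   Context: A tolerance relation on $S$ is a reflexive and symmetric binary relation. The granules $Gr(S)$ are a collection of subsets of $S$, associated with $T$, about which only $\bigcup Gr(S)=S$ is required. For $X\subseteq S$, write $X^c=S\setminus X$ and define $$Gr_*(X)=\bigcup\{A\in Gr(S): A\subseteq X\},\qquad Gr^*(X)=\bigcup\{A\in Gr(S): A\cap X\neq\emptyset\},$$ $$Gr_b^*(X)=Gr^*(X)\setminus Gr_*(X^c)\quad\text{(the bitten upper approximation)}.$$ For $A,B\in\wp(S)$ (the power set of $S$), put $A\sim B$ iff $Gr_*(A)=Gr_*(B)$ and $Gr_b^*(A)=Gr_b^*(B)$. This is an equivalence relation; $[A]$ denotes the class of $A$ and $\wp(S)|\sim$ the set of classes. The following are well defined on $\wp(S)|\sim$: $L([A])=[Gr_*(A)]$, ${\diamond}([A])=[Gr_b^*(A)]$, $\neg[A]=[A^c]$, and the partial order $[A]\leq[B]$ iff $Gr_*(A)\subseteq Gr_*(B)$ and $Gr_b^*(A)\subseteq Gr_b^*(B)$. $UB(a,b)$ is the set of minimal elements of $\{x: a\leq x,\ b\leq x\}$ and $LB(a,b)$ is the set of maximal elements of $\{x: x\leq a,\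 x\leq b\}$. A choice function on a set $K$ is a map $\lambda$ assigning to each nonempty subset $A\subseteq K$ an element $\lambda(A)\in A$ (so $\lambda(\{x\})=x$). In particular, if $a\leq b$ then $\lambda(UB(a,b))=b$ and $\lambda(LB(a,b))=a$. $\lambda$-lattice: let $P$ be a partially ordered set and, for $a,b\in P$, let $\mathrm{Low}(a,b)=\{x\in P: x\leq a,\ x\leq b\}$ and $\mathrm{Up}(a,b)=\{x\in P: a\leq x,\ b\leq x\}$ be the lower and upper cones of $\{a,b\}$. A function $\mu:\wp(P)\to P$ is lattice-coherent with the order of $P$ if and only if, whenever $a\leq b$, one has $\mu(\mathrm{Low}(a,b))=a$ and $\mu(\mathrm{Up}(a,b))=b$. If $\mu$ is lattice-coherent and one puts $a\cdot b=\mu(\mathrm{Low}(a,b))$ and $a+b=\mu(\mathrm{Up}(a,b))$, then the algebra on $P$ with the two operations $\cdot$ and $+$ is said to be a $\lambda$-lattice.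
   Formalization: In item 1, λ-lattice is read with two maps, one for lower and one for upper cones, instead of a single μ: with a single μ, Low(1,1) = Up(0,0) = P would force 1 = μ(P) = 0, which fails for every nonempty S. *)

theory Defs
  imports Main "HOL-Library.FuncSet"
begin

definition tolerance_on :: "'a set \<Rightarrow> ('a \<times> 'a) set \<Rightarrow> bool" where
  "tolerance_on S T \<longleftrightarrow> T \<subseteq> S \<times> S \<and> refl_on S T \<and> sym T"

definition gr_lower :: "'a set set \<Rightarrow> 'a set \<Rightarrow> 'a set" where
  "gr_lower Gr X = \<Union>{A \<in> Gr. A \<subseteq> X}"

definition gr_upper :: "'a set set \<Rightarrow> 'a set \<Rightarrow> 'a set" where
  "gr_upper Gr X = \<Union>{A \<in> Gr. A \<inter> X \<noteq> {}}"

definition gr_bitten :: "'a set \<Rightarrow> 'a set set \<Rightarrow> 'a set \<Rightarrow> 'a set" where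
  "gr_bitten S Gr X = gr_upper Gr X - gr_lower Gr (S - X)"

definition rough_eq :: "'a set \<Rightarrow> 'a set set \<Rightarrow> ('a set \<times> 'a set) set" where
  "rough_eq S Gr = {(A, B). A \<subseteq> S \<and> B \<subseteq> S \<and>
     gr_lower Gr A = gr_lower Gr B \<and> gr_bitten S Gr A = gr_bitten S Gr B}"

definition rough_class :: "'a set \<Rightarrow> 'a set set \<Rightarrow> 'a set \<Rightarrow> 'a set set" where
  "rough_class S Gr A = rough_eq S Gr `` {A}"

definition rough_quotient :: "'a set \<Rightarrow> 'a set set \<Rightarrow> 'a set set set" where
  "rough_quotient S Gr = Pow S // rough_eq S Gr"

text \<open>The operations on classes are lifted from representatives: the union over all
  representatives of a class is a union of equal classes. The lemmas \<open>rough_L_class\<close>,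
  \<open>rough_dia_class\<close>, \<open>rough_neg_class\<close> and \<open>rough_le_class\<close> below give the defining
  equations on classes.\<close>

definition rough_L :: "'a set \<Rightarrow> 'a set set \<Rightarrow> 'a set set \<Rightarrow> 'a set set" where
  "rough_L S Gr a = (\<Union>A\<in>a. rough_class S Gr (gr_lower Gr A))"

definition rough_dia :: "'a set \<Rightarrow> 'a set set \<Rightarrow> 'a set set \<Rightarrow> 'a set set" where
  "rough_dia S Gr a = (\<Union>A\<in>a. rough_class S Gr (gr_bitten S Gr A))"

definition rough_neg :: "'a set \<Rightarrow> 'a set set \<Rightarrow> 'a set set \<Rightarrow> 'a set set" where
  "rough_neg S Gr a = (\<Union>A\<in>a. rough_class S Gr (S - A))"

definition rough_le :: "'a set \<Rightarrow> 'a set set \<Rightarrow> 'a set set \<Rightarrow> 'a set set \<Rightarrow> bool" where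
  "rough_le S Gr a b \<longleftrightarrow> (\<exists>A\<in>a. \<exists>B\<in>b.
     gr_lower Gr A \<subseteq> gr_lower Gr B \<and> gr_bitten S Gr A \<subseteq> gr_bitten S Gr B)"

lemma equiv_rough_eq: "equiv (Pow S) (rough_eq S Gr)"
  by (rule equivI) (auto simp: rough_eq_def refl_on_def sym_def trans_def)

lemma rough_class_mem: "A \<subseteq> S \<Longrightarrow> A \<in> rough_class S Gr A"
  by (auto simp: rough_class_def rough_eq_def)

lemma rough_class_cong:
  "gr_lower Gr A = gr_lower Gr B \<Longrightarrow> gr_bitten S Gr A = gr_bitten S Gr B \<Longrightarrow>
   A \<subseteq> S \<Longrightarrow> B \<subseteq> S \<Longrightarrow> rough_class S Gr A = rough_class S Gr B"
  by (auto simp: rough_class_def rough_eq_def)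

lemma gr_bitten_eq:
  assumes "\<Union>Gr = S"
  shows "gr_bitten S Gr X = S - gr_lower Gr (S - X)"
  using assms unfolding gr_bitten_def gr_upper_def gr_lower_def by blast

lemma rough_L_class:
  assumes "A \<subseteq> S"
  shows "rough_L S Gr (rough_class S Gr A) = rough_class S Gr (gr_lower Gr A)"
proof -
  have "gr_lower Gr B = gr_lower Gr A" if "B \<in> rough_class S Gr A" for B
    using that by (simp add: rough_class_def rough_eq_def)
  then show ?thesis unfolding rough_L_def
    using rough_class_mem[OF assms] by (metis (no_types, lifting) SUP_eq_const empty_iff)
qed

lemma rough_dia_class:
  assumes "A \<subseteq> S"
  shows "rough_dia S Gr (rough_class S Gr A) = rough_class S Gr (gr_bitten S Gr A)"
proof -
  have "gr_bitten S Gr B = gr_bitten S Gr A" if "B \<in> rough_class S Gr A" for B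
    using that by (simp add: rough_class_def rough_eq_def)
  then show ?thesis unfolding rough_dia_def
    using rough_class_mem[OF assms] by (metis (no_types, lifting) SUP_eq_const empty_iff)
qed

lemma rough_neg_class:
  assumes "\<Union>Gr = S" "A \<subseteq> S"
  shows "rough_neg S Gr (rough_class S Gr A) = rough_class S Gr (S - A)"
proof -
  have "rough_class S Gr (S - B) = rough_class S Gr (S - A)" if "B \<in> rough_class S Gr A" for B
  proof (rule rough_class_cong)
    have B: "B \<subseteq> S" "gr_lower Gr B = gr_lower Gr A" "gr_bitten S Gr B = gr_bitten S Gr A"
      using that by (simp_all add: rough_class_def rough_eq_def)
    have sub: "gr_lower Gr (S - X) \<subseteq> S" for X
      unfolding gr_lower_def by blast
    show "gr_lower Gr (S - B) = gr_lower Gr (S - A)"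
      using B(3) sub[of A] sub[of B] unfolding gr_bitten_eq[OF assms(1)] by blast
    show "gr_bitten S Gr (S - B) = gr_bitten S Gr (S - A)"
      using B assms(2) by (simp add: gr_bitten_eq[OF assms(1)] double_diff)
  qed auto
  then show ?thesis unfolding rough_neg_def
    using rough_class_mem[OF assms(2)] by (metis (no_types, lifting) SUP_eq_const empty_iff)
qed

lemma rough_le_class:
  assumes "A \<subseteq> S" "B \<subseteq> S"
  shows "rough_le S Gr (rough_class S Gr A) (rough_class S Gr B) \<longleftrightarrow>
    gr_lower Gr A \<subseteq> gr_lower Gr B \<and> gr_bitten S Gr A \<subseteq> gr_bitten S Gr B"
  using assms by (auto simp: rough_le_def rough_class_def rough_eq_def)

definition lower_cone :: "'p set \<Rightarrow> ('p \<Rightarrow> 'p \<Rightarrow> bool) \<Rightarrow> 'p \<Rightarrow> 'p \<Rightarrow> 'p set" where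
  "lower_cone P le a b = {x \<in> P. le x a \<and> le x b}"

definition upper_cone :: "'p set \<Rightarrow> ('p \<Rightarrow> 'p \<Rightarrow> bool) \<Rightarrow> 'p \<Rightarrow> 'p \<Rightarrow> 'p set" where
  "upper_cone P le a b = {x \<in> P. le a x \<and> le b x}"

definition min_upper_bounds :: "'p set \<Rightarrow> ('p \<Rightarrow> 'p \<Rightarrow> bool) \<Rightarrow> 'p \<Rightarrow> 'p \<Rightarrow> 'p set" where
  "min_upper_bounds P le a b =
     {x \<in> upper_cone P le a b. \<forall>y\<in>upper_cone P le a b. le y x \<longrightarrow> y = x}"

definition max_lower_bounds :: "'p set \<Rightarrow> ('p \<Rightarrow> 'p \<Rightarrow> bool) \<Rightarrow> 'p \<Rightarrow> 'p \<Rightarrow> 'p set" where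
  "max_lower_bounds P le a b =
     {x \<in> lower_cone P le a b. \<forall>y\<in>lower_cone P le a b. le x y \<longrightarrow> y = x}"

definition choice_function_on :: "'p set \<Rightarrow> ('p set \<Rightarrow> 'p) \<Rightarrow> bool" where
  "choice_function_on K f \<longleftrightarrow> (\<forall>A. A \<subseteq> K \<and> A \<noteq> {} \<longrightarrow> f A \<in> A)"

text \<open>A single map \<open>\<mu>\<close> on subsets cannot serve both kinds of cones in a poset with distinct
  least and greatest elements \<open>0\<close> and \<open>1\<close>: the whole poset is both the lower cone of
  \<open>1, 1\<close> and the upper cone of \<open>0, 0\<close>, so coherence would give
  \<open>1 = \<mu> P = 0\<close>. Hence the value of \<open>\<mu>\<close> is allowed to depend on whether its argument is
  taken as a lower cone (\<open>\<mu>l\<close>) or as an upper cone (\<open>\<mu>u\<close>).\<close>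

definition lattice_coherent ::
  "'p set \<Rightarrow> ('p \<Rightarrow> 'p \<Rightarrow> bool) \<Rightarrow> ('p set \<Rightarrow> 'p) \<Rightarrow> ('p set \<Rightarrow> 'p) \<Rightarrow> bool" where
  "lattice_coherent P le \<mu>l \<mu>u \<longleftrightarrow>
     \<mu>l \<in> Pow P \<rightarrow> P \<and> \<mu>u \<in> Pow P \<rightarrow> P \<and>
     (\<forall>a\<in>P. \<forall>b\<in>P. le a b \<longrightarrow>
        \<mu>l (lower_cone P le a b) = a \<and> \<mu>u (upper_cone P le a b) = b)"

definition lambda_lattice ::
  "'p set \<Rightarrow> ('p \<Rightarrow> 'p \<Rightarrow> bool) \<Rightarrow> ('p \<Rightarrow> 'p \<Rightarrow> 'p) \<Rightarrow> ('p \<Rightarrow> 'p \<Rightarrow> 'p) \<Rightarrow> bool" where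
  "lambda_lattice P le join meet \<longleftrightarrow>
     reflp_on P le \<and> transp_on P le \<and> antisymp_on P le \<and>
     (\<exists>\<mu>l \<mu>u. lattice_coherent P le \<mu>l \<mu>u \<and>
        (\<forall>a\<in>P. \<forall>b\<in>P. meet a b = \<mu>l (lower_cone P le a b) \<and>
                       join a b = \<mu>u (upper_cone P le a b)))"

end

theory Submission
  imports Defs
begin

text \<open>The lower approximation is an interior operator: it is monotone, deflationary and idempotent, because a granule inside \<open>X\<close>
  is also inside the union of all granules inside \<open>X\<close>. Since the granules cover \<open>S\<close>, the bitten
  upper approximation of \<open>X\<close> is the complement of the lower approximation of \<open>S - X\<close>, so it is
  the dual closure operator (\<open>gr_bitten_mono\<close>, \<open>gr_bitten_extensive\<close>, \<open>gr_bitten_idem\<close>). On classes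
  these properties say that \<open>L\<close> is an interior operator, that \<open>\<diamond>\<close> is a closure operator, and that
  \<open>\<not>\<close> exchanges them.

  For the operations it matters only that \<open>a \<cdot> b\<close> is some maximal lower bound of \<open>a\<close> and \<open>b\<close>, the
  choice depending on nothing but the unordered pair. If \<open>a \<le> b\<close>, then \<open>a\<close> is the unique maximal
  lower bound, so every choice picks it; conversely \<open>a \<cdot> b = a\<close> forces \<open>a \<le> b\<close> because
  \<open>a \<cdot> b\<close> is a lower bound of \<open>b\<close>. Thus \<open>a \<cdot> b = a\<close> is just another way of writing \<open>a \<le> b\<close>
  (\<open>meet_eq_left_iff\<close>). Reversing the order turns meets into joins, so \<open>a + b = a\<close> likewise
  means \<open>b \<le> a\<close>. Every identity then becomes an inequality: absorption and weak associativity say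
  that bounds are bounds, and the laws with \<open>L\<close> and \<open>\<diamond>\<close> express deflation, inflation
  and monotonicity. Finally, the maximal lower bounds of \<open>a\<close> and \<open>b\<close> are the maximal elements of their
  lower cone, so the chosen meet is a function of the cone alone; this is what a
  \<open>\<lambda>\<close>-lattice asks for.\<close>

section \<open>Meets and joins by choice\<close>

text \<open>The locale speaks of lower bounds only; the operation \<open>+\<close> is the same construction for the
  reversed order, so no fact has to be proved twice.\<close>

locale meet_by_choice =
  fixes P :: "'p set" and le :: "'p \<Rightarrow> 'p \<Rightarrow> bool" and lam :: "'p set \<Rightarrow> 'p"
  assumes refl: "reflp_on P le"
    and trans: "transp_on P le"
    and antisym: "antisymp_on P le"
    and bounds: "a \<in> P \<Longrightarrow> b \<in> P \<Longrightarrow> max_lower_bounds P le a b \<noteq> {}"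
    and choice: "choice_function_on P lam"
begin

definition meet :: "'p \<Rightarrow> 'p \<Rightarrow> 'p" where
  "meet a b = lam (max_lower_bounds P le a b)"

lemma meet_maximal:
  assumes "a \<in> P" "b \<in> P"
  shows "meet a b \<in> max_lower_bounds P le a b"
proof -
  have "max_lower_bounds P le a b \<subseteq> P"
    by (auto simp: max_lower_bounds_def lower_cone_def)
  then show ?thesis
    using bounds[OF assms] choice by (simp add: meet_def choice_function_on_def)
qed

lemma meet_closed: "a \<in> P \<Longrightarrow> b \<in> P \<Longrightarrow> meet a b \<in> P"
  and meet_le_left: "a \<in> P \<Longrightarrow> b \<in> P \<Longrightarrow> le (meet a b) a"
  and meet_le_right: "a \<in> P \<Longrightarrow> b \<in> P \<Longrightarrow> le (meet a b) b"
  using meet_maximal by (simp_all add: max_lower_bounds_def lower_cone_def)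

lemma meet_commute: "meet a b = meet b a"
proof -
  have "max_lower_bounds P le a b = max_lower_bounds P le b a"
    by (auto simp: max_lower_bounds_def lower_cone_def)
  then show ?thesis
    by (simp add: meet_def)
qed

text \<open>If \<open>a \<le> b\<close>, then \<open>a\<close> is the greatest lower bound, so nothing else is maximal and the
  choice is forced.\<close>

lemma meet_eq_left_iff:
  assumes "a \<in> P" "b \<in> P"
  shows "meet a b = a \<longleftrightarrow> le a b"
proof
  assume "meet a b = a"
  then show "le a b"
    using meet_le_right[OF assms] by simp
next
  assume "le a b"
  then have a: "a \<in> lower_cone P le a b"
    using assms reflp_onD[OF refl] by (simp add: lower_cone_def)
  then show "meet a b = a"
    using meet_maximal[OF assms] meet_le_left[OF assms] by (auto simp: max_lower_bounds_def)
qed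

lemma meet_eq_right:
  assumes "a \<in> P" "b \<in> P" "le b a"
  shows "meet a b = b"
  using meet_eq_left_iff[of b a] assms meet_commute by simp

lemma meet_idem: "a \<in> P \<Longrightarrow> meet a a = a"
  using meet_eq_left_iff reflp_onD[OF refl] by simp

text \<open>The special case \<open>x = b \<cdot> c\<close> is the weak form of associativity that survives although
  a maximal lower bound of \<open>a\<close> and \<open>b \<cdot> c\<close> need not be one of \<open>a \<cdot> b\<close> and \<open>c\<close>.\<close>

lemma meet_left_idem:
  assumes "a \<in> P" "x \<in> P"
  shows "meet a (meet a x) = meet a x"
  using assms by (intro meet_eq_right meet_closed meet_le_left)

text \<open>The maximal lower bounds of \<open>a\<close> and \<open>b\<close> can be recovered from the lower cone as a bare set:
  they are its maximal elements. A set without maximal elements is never such a cone, and there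
  \<open>\<mu>\<close> takes an arbitrary value in \<open>P\<close>.\<close>

lemma meet_factors_through_lower_cone:
  assumes "P \<noteq> {}"
  obtains \<mu> where "\<mu> \<in> Pow P \<rightarrow> P"
    and "\<And>a b. a \<in> P \<Longrightarrow> b \<in> P \<Longrightarrow> meet a b = \<mu> (lower_cone P le a b)"
proof -
  obtain p where p: "p \<in> P"
    using assms by blast
  define maxs where "maxs C = {x \<in> C. \<forall>y\<in>C. le x y \<longrightarrow> y = x}" for C
  define \<mu> where "\<mu> C = (if maxs C = {} then p else lam (maxs C))" for C
  have "lam (maxs C) \<in> P" if "C \<subseteq> P" "maxs C \<noteq> {}" for C
  proof -
    have "maxs C \<subseteq> P"
      using that by (auto simp: maxs_def)
    moreover from this have "lam (maxs C) \<in> maxs C"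
      using that(2) choice by (simp add: choice_function_on_def)
    ultimately show ?thesis
      by (rule subsetD)
  qed
  then have "\<mu> \<in> Pow P \<rightarrow> P"
    using p by (auto simp: \<mu>_def)
  moreover have "meet a b = \<mu> (lower_cone P le a b)" if "a \<in> P" "b \<in> P" for a b
  proof -
    have "max_lower_bounds P le a b = maxs (lower_cone P le a b)"
      by (simp add: max_lower_bounds_def maxs_def)
    then show ?thesis
      using bounds[OF that] by (simp add: meet_def \<mu>_def)
  qed
  ultimately show ?thesis
    by (rule that)
qed

end

lemma lower_cone_reverse: "lower_cone P (\<lambda>x y. le y x) = upper_cone P le"
  by (auto simp: fun_eq_iff lower_cone_def upper_cone_def)

lemma max_lower_bounds_reverse: "max_lower_bounds P (\<lambda>x y. le y x) = min_upper_bounds P le"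
  by (simp add: fun_eq_iff max_lower_bounds_def min_upper_bounds_def lower_cone_reverse)

locale join_meet_by_choice = meet_by_choice +
  assumes upper_bounds: "a \<in> P \<Longrightarrow> b \<in> P \<Longrightarrow> min_upper_bounds P le a b \<noteq> {}"
begin

sublocale dual: meet_by_choice P "\<lambda>x y. le y x" lam
proof
  show "reflp_on P (\<lambda>x y. le y x)"
    using refl by (auto simp: reflp_on_def)
  show "transp_on P (\<lambda>x y. le y x)"
    using trans unfolding transp_on_def by blast
  show "antisymp_on P (\<lambda>x y. le y x)"
    using antisym unfolding antisymp_on_def by blast
  show "max_lower_bounds P (\<lambda>x y. le y x) a b \<noteq> {}" if "a \<in> P" "b \<in> P" for a b
    using upper_bounds[OF that] by (simp add: max_lower_bounds_reverse)
qed (rule choice)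

abbreviation join :: "'a \<Rightarrow> 'a \<Rightarrow> 'a" where
  "join \<equiv> dual.meet"

lemma join_def: "join a b = lam (min_upper_bounds P le a b)"
  by (simp add: dual.meet_def max_lower_bounds_reverse)

lemma join_meet_absorb: "a \<in> P \<Longrightarrow> b \<in> P \<Longrightarrow> join a (meet a b) = a"
  using dual.meet_eq_left_iff meet_closed meet_le_left by blast

lemma meet_join_absorb: "a \<in> P \<Longrightarrow> b \<in> P \<Longrightarrow> meet a (join a b) = a"
  using meet_eq_left_iff dual.meet_closed dual.meet_le_left by blast

lemma le_iff_join: "a \<in> P \<Longrightarrow> b \<in> P \<Longrightarrow> join b a = b \<longleftrightarrow> le a b"
  by (rule dual.meet_eq_left_iff)

lemma lambda_lattice_join_meet:
  assumes "P \<noteq> {}"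
  shows "lambda_lattice P le join meet"
proof -
  obtain \<mu>l where l: "\<mu>l \<in> Pow P \<rightarrow> P"
    "\<And>a b. a \<in> P \<Longrightarrow> b \<in> P \<Longrightarrow> meet a b = \<mu>l (lower_cone P le a b)"
    using meet_factors_through_lower_cone[OF assms] by blast
  obtain \<mu>u where u: "\<mu>u \<in> Pow P \<rightarrow> P"
    "\<And>a b. a \<in> P \<Longrightarrow> b \<in> P \<Longrightarrow> join a b = \<mu>u (upper_cone P le a b)"
    using dual.meet_factors_through_lower_cone[OF assms] unfolding lower_cone_reverse by blast
  have "\<mu>l (lower_cone P le a b) = a" "\<mu>u (upper_cone P le a b) = b"
    if "a \<in> P" "b \<in> P" "le a b" for a b
    using that l(2)[of a b] u(2)[of a b] meet_eq_left_iff[of a b] dual.meet_eq_right[of a b]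
    by simp_all
  then have "lattice_coherent P le \<mu>l \<mu>u"
    using l(1) u(1) by (simp add: lattice_coherent_def)
  then show ?thesis
    using refl trans antisym l(2) u(2) unfolding lambda_lattice_def by blast
qed

end

section \<open>Granular approximations as interior and closure operators\<close>

lemma gr_lower_mono: "X \<subseteq> Y \<Longrightarrow> gr_lower Gr X \<subseteq> gr_lower Gr Y"
  unfolding gr_lower_def by blast

lemma gr_lower_subset: "gr_lower Gr X \<subseteq> X"
  unfolding gr_lower_def by blast

lemma gr_lower_idem: "gr_lower Gr (gr_lower Gr X) = gr_lower Gr X"
  unfolding gr_lower_def by blast

text \<open>For a covering family of granules \<open>gr_bitten_eq\<close> presents the bitten upper approximation as
  the complement-conjugate of the interior operator \<open>gr_lower\<close>, so its closure properties are
  the duals of the three facts above.\<close>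

context
  fixes S :: "'a set" and Gr :: "'a set set"
  assumes cover: "\<Union>Gr = S"
begin

lemma gr_bitten_subset_carrier: "gr_bitten S Gr X \<subseteq> S"
  by (auto simp: gr_bitten_eq[OF cover])

lemma gr_bitten_mono:
  assumes "X \<subseteq> Y"
  shows "gr_bitten S Gr X \<subseteq> gr_bitten S Gr Y"
  using gr_lower_mono[of "S - Y" "S - X" Gr] assms by (auto simp: gr_bitten_eq[OF cover])

lemma gr_bitten_extensive:
  assumes "X \<subseteq> S"
  shows "X \<subseteq> gr_bitten S Gr X"
  using gr_lower_subset[of Gr "S - X"] assms by (auto simp: gr_bitten_eq[OF cover])

lemma compl_gr_bitten: "S - gr_bitten S Gr X = gr_lower Gr (S - X)"
  using gr_lower_subset[of Gr "S - X"] by (auto simp: gr_bitten_eq[OF cover])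

lemma compl_gr_lower:
  assumes "X \<subseteq> S"
  shows "S - gr_lower Gr X = gr_bitten S Gr (S - X)"
  using assms by (simp add: gr_bitten_eq[OF cover] double_diff)

lemma gr_bitten_idem: "gr_bitten S Gr (gr_bitten S Gr X) = gr_bitten S Gr X"
proof -
  have "gr_bitten S Gr (gr_bitten S Gr X) = S - gr_lower Gr (S - gr_bitten S Gr X)"
    by (rule gr_bitten_eq[OF cover])
  then show ?thesis
    by (simp only: compl_gr_bitten gr_lower_idem gr_bitten_eq[OF cover, symmetric])
qed

lemma gr_lower_carrier: "gr_lower Gr S = S"
  using cover unfolding gr_lower_def by blast

lemma gr_lower_empty: "gr_lower Gr {} = {}"
  unfolding gr_lower_def by blast

lemma gr_bitten_carrier: "gr_bitten S Gr S = S"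
  by (simp add: gr_bitten_eq[OF cover] gr_lower_empty)

lemma gr_bitten_empty: "gr_bitten S Gr {} = {}"
  by (simp add: gr_bitten_eq[OF cover] gr_lower_carrier)

section \<open>The quotient by rough equality\<close>

lemma rough_quotient_eq: "rough_quotient S Gr = rough_class S Gr ` Pow S"
  unfolding rough_quotient_def quotient_def rough_class_def by blast

lemma rough_class_in_quotient: "A \<subseteq> S \<Longrightarrow> rough_class S Gr A \<in> rough_quotient S Gr"
  by (simp add: rough_quotient_eq)

lemma rough_quotient_cases:
  assumes "a \<in> rough_quotient S Gr"
  obtains A where "A \<subseteq> S" "a = rough_class S Gr A"
  using assms by (auto simp: rough_quotient_eq)

lemma reflp_rough_le: "reflp_on (rough_quotient S Gr) (rough_le S Gr)"
  by (auto simp: reflp_on_def rough_quotient_eq rough_le_class)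

lemma transp_rough_le: "transp_on (rough_quotient S Gr) (rough_le S Gr)"
  by (auto simp: transp_on_def rough_quotient_eq rough_le_class)

lemma antisymp_rough_le: "antisymp_on (rough_quotient S Gr) (rough_le S Gr)"
proof (rule antisymp_onI)
  fix a b assume ab: "a \<in> rough_quotient S Gr" "b \<in> rough_quotient S Gr"
    "rough_le S Gr a b" "rough_le S Gr b a"
  obtain A B where AB: "A \<subseteq> S" "a = rough_class S Gr A" "B \<subseteq> S" "b = rough_class S Gr B"
    using ab(1,2) by (meson rough_quotient_cases)
  have "gr_lower Gr A = gr_lower Gr B" "gr_bitten S Gr A = gr_bitten S Gr B"
    using ab(3,4) AB by (auto simp: rough_le_class)
  then show "a = b"
    unfolding AB(2,4) using AB(1,3) by (rule rough_class_cong)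
qed

lemma rough_L_closed:
  assumes "a \<in> rough_quotient S Gr"
  shows "rough_L S Gr a \<in> rough_quotient S Gr"
proof (rule rough_quotient_cases[OF assms])
  fix A assume "A \<subseteq> S" "a = rough_class S Gr A"
  then show ?thesis
    using gr_lower_subset[of Gr A] by (auto simp: rough_L_class intro!: rough_class_in_quotient)
qed

lemma rough_dia_closed:
  assumes "a \<in> rough_quotient S Gr"
  shows "rough_dia S Gr a \<in> rough_quotient S Gr"
  using assms rough_class_in_quotient gr_bitten_subset_carrier
  by (metis rough_dia_class rough_quotient_cases)

lemma rough_L_le:
  assumes "a \<in> rough_quotient S Gr"
  shows "rough_le S Gr (rough_L S Gr a) a"
proof (rule rough_quotient_cases[OF assms])
  fix A assume A: "A \<subseteq> S" "a = rough_class S Gr A"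
  have "gr_lower Gr A \<subseteq> S"
    using gr_lower_subset[of Gr A] A(1) by simp
  then show ?thesis
    using A by (simp add: rough_L_class rough_le_class gr_lower_subset gr_bitten_mono)
qed

lemma le_rough_dia:
  assumes "a \<in> rough_quotient S Gr"
  shows "rough_le S Gr a (rough_dia S Gr a)"
proof (rule rough_quotient_cases[OF assms])
  fix A assume A: "A \<subseteq> S" "a = rough_class S Gr A"
  then show ?thesis
    by (simp add: rough_dia_class rough_le_class gr_bitten_subset_carrier gr_bitten_idem
        gr_lower_mono gr_bitten_extensive)
qed

lemma rough_L_idem:
  assumes "a \<in> rough_quotient S Gr"
  shows "rough_L S Gr (rough_L S Gr a) = rough_L S Gr a"
proof (rule rough_quotient_cases[OF assms])
  fix A assume A: "A \<subseteq> S" "a = rough_class S Gr A"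
  have "gr_lower Gr A \<subseteq> S"
    using gr_lower_subset[of Gr A] A(1) by simp
  then show ?thesis
    using A by (simp add: rough_L_class gr_lower_idem)
qed

lemma rough_dia_idem:
  assumes "a \<in> rough_quotient S Gr"
  shows "rough_dia S Gr (rough_dia S Gr a) = rough_dia S Gr a"
proof (rule rough_quotient_cases[OF assms])
  fix A assume A: "A \<subseteq> S" "a = rough_class S Gr A"
  then show ?thesis
    by (simp add: rough_dia_class gr_bitten_subset_carrier gr_bitten_idem)
qed

text \<open>Both approximations of \<open>gr_lower Gr A\<close> are monotone functions of \<open>gr_lower Gr A\<close>, so the
  comparison of lower approximations alone carries the argument; dually for \<open>\<diamond>\<close>.\<close>

lemma rough_L_mono:
  assumes "a \<in> rough_quotient S Gr" "b \<in> rough_quotient S Gr" "rough_le S Gr a b"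
  shows "rough_le S Gr (rough_L S Gr a) (rough_L S Gr b)"
proof -
  obtain A B where A: "A \<subseteq> S" "a = rough_class S Gr A" and B: "B \<subseteq> S" "b = rough_class S Gr B"
    using assms(1,2) by (meson rough_quotient_cases)
  have "gr_lower Gr A \<subseteq> gr_lower Gr B"
    using assms(3) A B by (simp add: rough_le_class)
  moreover have "gr_lower Gr A \<subseteq> S" "gr_lower Gr B \<subseteq> S"
    using gr_lower_subset A(1) B(1) by (meson order_trans)+
  ultimately show ?thesis
    using A B by (simp add: rough_L_class rough_le_class gr_lower_mono gr_bitten_mono)
qed

lemma rough_dia_mono:
  assumes "a \<in> rough_quotient S Gr" "b \<in> rough_quotient S Gr" "rough_le S Gr a b"
  shows "rough_le S Gr (rough_dia S Gr a) (rough_dia S Gr b)"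
proof -
  obtain A B where A: "A \<subseteq> S" "a = rough_class S Gr A" and B: "B \<subseteq> S" "b = rough_class S Gr B"
    using assms(1,2) by (meson rough_quotient_cases)
  have "gr_bitten S Gr A \<subseteq> gr_bitten S Gr B"
    using assms(3) A B by (simp add: rough_le_class)
  then show ?thesis
    using A B by (simp add: rough_dia_class rough_le_class gr_bitten_subset_carrier
        gr_lower_mono gr_bitten_mono)
qed

lemma rough_neg_L:
  assumes "a \<in> rough_quotient S Gr"
  shows "rough_neg S Gr (rough_L S Gr a) = rough_dia S Gr (rough_neg S Gr a)"
proof (rule rough_quotient_cases[OF assms])
  fix A assume A: "A \<subseteq> S" "a = rough_class S Gr A"
  have "gr_lower Gr A \<subseteq> S"
    using gr_lower_subset[of Gr A] A(1) by simp
  then show ?thesis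
    using A by (simp add: rough_L_class rough_dia_class rough_neg_class[OF cover] compl_gr_lower)
qed

lemma rough_neg_dia:
  assumes "a \<in> rough_quotient S Gr"
  shows "rough_neg S Gr (rough_dia S Gr a) = rough_L S Gr (rough_neg S Gr a)"
proof (rule rough_quotient_cases[OF assms])
  fix A assume A: "A \<subseteq> S" "a = rough_class S Gr A"
  then show ?thesis
    by (simp add: rough_L_class rough_dia_class rough_neg_class[OF cover]
        gr_bitten_subset_carrier compl_gr_bitten)
qed

end

section \<open>The algebra of the bitten granular semantics\<close>

theorem theorem4p1:
  fixes S :: "'a set" and T :: "('a \<times> 'a) set" and Gr :: "'a set set"
    and lam :: "'a set set set \<Rightarrow> 'a set set"
    and P :: "'a set set set"
    and le :: "'a set set \<Rightarrow> 'a set set \<Rightarrow> bool"  (infix "\<preceq>" 50)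
    and join :: "'a set set \<Rightarrow> 'a set set \<Rightarrow> 'a set set"  (infixl "\<oplus>" 65)
    and meet :: "'a set set \<Rightarrow> 'a set set \<Rightarrow> 'a set set"  (infixl "\<odot>" 70)
    and L dia neg :: "'a set set \<Rightarrow> 'a set set"
    and zero one :: "'a set set"
  defines "P \<equiv> rough_quotient S Gr"
    and "le \<equiv> rough_le S Gr"
    and "join \<equiv> \<lambda>a b. lam (min_upper_bounds P le a b)"
    and "meet \<equiv> \<lambda>a b. lam (max_lower_bounds P le a b)"
    and "L \<equiv> rough_L S Gr"
    and "dia \<equiv> rough_dia S Gr"
    and "neg \<equiv> rough_neg S Gr"
    and "zero \<equiv> rough_class S Gr {}"
    and "one \<equiv> rough_class S Gr S"
  assumes tolerance: "tolerance_on S T"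
    and granules: "Gr \<subseteq> Pow S" "\<Union>Gr = S"
    and bounds: "\<And>a b. a \<in> P \<Longrightarrow> b \<in> P \<Longrightarrow>
      min_upper_bounds P le a b \<noteq> {} \<and> max_lower_bounds P le a b \<noteq> {}"
    and choice: "choice_function_on P lam"
  shows "lambda_lattice P le join meet \<and>
    (\<forall>a\<in>P. \<forall>b\<in>P. \<forall>c\<in>P.
      (a \<oplus> b = b \<oplus> a \<and> a \<odot> b = b \<odot> a) \<and>
      (a \<oplus> a = a \<and> a \<odot> a = a) \<and>
      (a \<oplus> (a \<odot> b) = a \<and> a \<odot> (a \<oplus> b) = a) \<and>
      (a \<oplus> (a \<oplus> (b \<oplus> c)) = a \<oplus> (b \<oplus> c) \<and> a \<odot> (a \<odot> (b \<odot> c)) = a \<odot> (b \<odot> c)) \<and>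
      (a \<oplus> L a = a \<and> a \<odot> L a = L a) \<and>
      (a \<oplus> dia a = dia a \<and> a \<odot> dia a = a) \<and>
      (L (L a) = L a \<and> dia (dia a) = dia a) \<and>
      ((a \<oplus> b = a \<longrightarrow> L a \<oplus> L b = L a) \<and> (a \<odot> b = a \<longrightarrow> L a \<odot> L b = L a)) \<and>
      ((a \<oplus> b = a \<longrightarrow> dia a \<oplus> dia b = dia a) \<and> (a \<odot> b = a \<longrightarrow> dia a \<odot> dia b = dia a)) \<and>
      (neg (L a) = dia (neg a) \<and> neg (dia a) = L (neg a)) \<and>
      (L zero = zero \<and> L one = one \<and> dia zero = zero \<and> dia one = one) \<and>
      (L (dia a) \<oplus> dia a = dia a \<and> L (dia a) \<odot> dia a = L (dia a)) \<and>
      (L a \<oplus> dia (L a) = dia (L a) \<and> L a \<odot> dia (L a) = L a))"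
proof -
  interpret Q: join_meet_by_choice P le lam
  proof
    show "reflp_on P le" "transp_on P le" "antisymp_on P le"
      unfolding P_def le_def
      by (fact reflp_rough_le[OF granules(2)] transp_rough_le[OF granules(2)]
          antisymp_rough_le[OF granules(2)])+
  qed (use bounds choice in auto)
  have join: "join = Q.join" and meet: "meet = Q.meet"
    by (simp_all add: fun_eq_iff join_def meet_def Q.join_def Q.meet_def)
  have closed: "L a \<in> P" "dia a \<in> P" if "a \<in> P" for a
    using that rough_L_closed[OF granules(2)] rough_dia_closed[OF granules(2)]
    by (simp_all add: P_def L_def dia_def)
  have below: "L a \<preceq> a" and above: "a \<preceq> dia a" if "a \<in> P" for a
    using that rough_L_le[OF granules(2)] le_rough_dia[OF granules(2)]
    by (simp_all add: P_def le_def L_def dia_def)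
  have mono: "L a \<preceq> L b" "dia a \<preceq> dia b" if "a \<in> P" "b \<in> P" "a \<preceq> b" for a b
    using that rough_L_mono[OF granules(2)] rough_dia_mono[OF granules(2)]
    by (simp_all add: P_def le_def L_def dia_def)
  have idem: "L (L a) = L a" "dia (dia a) = dia a" if "a \<in> P" for a
    using that rough_L_idem[OF granules(2)] rough_dia_idem[OF granules(2)]
    by (simp_all add: P_def L_def dia_def)
  have neg: "neg (L a) = dia (neg a)" "neg (dia a) = L (neg a)" if "a \<in> P" for a
    using that rough_neg_L[OF granules(2)] rough_neg_dia[OF granules(2)]
    by (simp_all add: P_def L_def dia_def neg_def)
  have bounds01: "L zero = zero" "L one = one" "dia zero = zero" "dia one = one"
    using granules(2)
    by (simp_all add: L_def dia_def zero_def one_def rough_L_class rough_dia_class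
        gr_lower_empty gr_lower_carrier gr_bitten_empty gr_bitten_carrier)
  \<comment> \<open>Comparability determines both operations, and is determined by either of them.\<close>
  have cmp: "a \<oplus> b = b" "b \<oplus> a = b" "a \<odot> b = a" "b \<odot> a = a"
    if "a \<in> P" "b \<in> P" "a \<preceq> b" for a b
    using that Q.le_iff_join Q.meet_eq_left_iff Q.meet_commute Q.dual.meet_commute
    by (simp_all add: join meet)
  have le_of_join: "b \<preceq> a" if "a \<in> P" "b \<in> P" "a \<oplus> b = a" for a b
    using that Q.le_iff_join by (simp add: join)
  have le_of_meet: "a \<preceq> b" if "a \<in> P" "b \<in> P" "a \<odot> b = a" for a b
    using that Q.meet_eq_left_iff by (simp add: meet)
  have "P \<noteq> {}"
    using rough_class_in_quotient[OF granules(2), of "{}"] by (auto simp: P_def)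
  then have lattice: "lambda_lattice P le join meet"
    unfolding join meet by (rule Q.lambda_lattice_join_meet)
  have commute: "a \<oplus> b = b \<oplus> a" "a \<odot> b = b \<odot> a" for a b
    unfolding join meet by (rule Q.dual.meet_commute, rule Q.meet_commute)
  have lattice_laws: "a \<oplus> a = a" "a \<odot> a = a" "a \<oplus> (a \<odot> b) = a" "a \<odot> (a \<oplus> b) = a"
      "a \<oplus> (a \<oplus> (b \<oplus> c)) = a \<oplus> (b \<oplus> c)" "a \<odot> (a \<odot> (b \<odot> c)) = a \<odot> (b \<odot> c)"
    if "a \<in> P" "b \<in> P" "c \<in> P" for a b c
    unfolding join meet using that
    by (simp_all add: Q.meet_idem Q.dual.meet_idem Q.join_meet_absorb Q.meet_join_absorb
        Q.meet_left_idem Q.dual.meet_left_idem Q.meet_closed Q.dual.meet_closed)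
  have operator_laws: "a \<oplus> L a = a" "a \<odot> L a = L a" "a \<oplus> dia a = dia a" "a \<odot> dia a = a"
      "L (dia a) \<oplus> dia a = dia a" "L (dia a) \<odot> dia a = L (dia a)"
      "L a \<oplus> dia (L a) = dia (L a)" "L a \<odot> dia (L a) = L a" if "a \<in> P" for a
    using that by (simp_all add: cmp closed below above)
  have mono_laws: "L a \<oplus> L b = L a" "dia a \<oplus> dia b = dia a"
    if "a \<in> P" "b \<in> P" "a \<oplus> b = a" for a b
    using mono[OF that(2,1) le_of_join[OF that]] that(1,2) by (simp_all add: cmp closed)
  have mono_laws': "L a \<odot> L b = L a" "dia a \<odot> dia b = dia a"
    if "a \<in> P" "b \<in> P" "a \<odot> b = a" for a b
    using mono[OF that(1,2) le_of_meet[OF that]] that(1,2) by (simp_all add: cmp closed)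
  show ?thesis
    by (intro conjI[OF lattice] ballI conjI impI commute lattice_laws operator_laws
        mono_laws mono_laws' idem neg bounds01)
qed

end
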